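(* Let $\gamma>1$, $\bar u,\bar v>0$, and suppose $w:=\bar u^{\frac{1-\gamma}{2}}+\frac{1-\gamma}{2}\bar v<0$. Let $r$ be defined by $$r(\xi)=\frac{\gamma+1}{\gamma-1}\,\xi^{\frac{\gamma-1}{\gamma+1}}-\frac{2}{\gamma-1}w\quad\text{for }\xi>0,\qquad r(\xi)=-r(-\xi)\quad\text{for }\xi<0.$$ Then the function $y(x,t):=t\,r\big(\frac xt\big)$ is a self-similar slic-solution of the $p$-system $$u_t-v_x=0,\qquad v_t+p(u)_x=0\qquad\text{in }\mathbb{R}\times(0,\infty),\qquad p(u)=\tfrac1\gamma u^{-\gamma}.$$
   Context: Here $u$ denotes specific volume and $v$ velocity. Definition (self-similar slic-solution; slic = singular limiting induced from continuum). A mollifier is a function $\phi\in C_c^\infty(\mathbb{R})$ with $\phi\ge0$, $\operatorname{supp}\phi\subset(-1,1)$, $\int\phi=1$; set $\phi_n(\xi)=n\phi(n\xi)$. For $r\in L^1_{loc}(\mathbb{R})$, the function $y(x,t)=t\,r(x/t)$ is called a self-similar slic-solution of the $p$-system if the sequences $$r_n:=\phi_n\star r\ (\text{convolution in }\xi),\qquad u_n(\xi):=r_n'(\xi),\qquad v_n(\xi):=r_n(\xi)-\xi r_n'(\xi)$$ fulfill $$\int_{-\infty}^\infty\Big(\tfrac1\gamma(u_n)^{-\gamma}-\xi v_n\Big)\psi_\xi-v_n\psi\,d\xi\to0\quad\text{as }n\to\infty$$ for all mollifiers $\phi$ and all $\psi\in C_c^1(\mathbb{R})$. *)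

theory Defs
  imports "HOL-Analysis.Analysis"
begin

definition L1_loc :: "(real \<Rightarrow> real) \<Rightarrow> bool" where
  "L1_loc r \<longleftrightarrow> (\<forall>K. compact K \<longrightarrow> r absolutely_integrable_on K)"

definition supp :: "(real \<Rightarrow> real) \<Rightarrow> real set" where
  "supp f = closure {x. f x \<noteq> 0}"

definition Cc1 :: "(real \<Rightarrow> real) \<Rightarrow> bool" where
  "Cc1 \<psi> \<longleftrightarrow> \<psi> C1_differentiable_on UNIV \<and> compact (supp \<psi>)"

definition Cc_infinity :: "(real \<Rightarrow> real) \<Rightarrow> bool" where
  "Cc_infinity \<phi> \<longleftrightarrow>
     (\<forall>k. (deriv ^^ k) \<phi> differentiable_on UNIV) \<and> compact (supp \<phi>)"

definition mollifier :: "(real \<Rightarrow> real) \<Rightarrow> bool" where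
  "mollifier \<phi> \<longleftrightarrow>
     Cc_infinity \<phi> \<and> (\<forall>x. 0 \<le> \<phi> x) \<and> supp \<phi> \<subseteq> {-1<..<1} \<and> (LINT x|lebesgue. \<phi> x) = 1"

definition scaled :: "(real \<Rightarrow> real) \<Rightarrow> nat \<Rightarrow> real \<Rightarrow> real" where
  "scaled \<phi> n = (\<lambda>\<xi>. real n * \<phi> (real n * \<xi>))"

definition conv :: "(real \<Rightarrow> real) \<Rightarrow> (real \<Rightarrow> real) \<Rightarrow> real \<Rightarrow> real" where
  "conv f g = (\<lambda>\<xi>. LINT \<eta>|lebesgue. f (\<xi> - \<eta>) * g \<eta>)"

definition r_seq :: "(real \<Rightarrow> real) \<Rightarrow> (real \<Rightarrow> real) \<Rightarrow> nat \<Rightarrow> real \<Rightarrow> real" where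
  "r_seq \<phi> r n = conv (scaled \<phi> n) r"

definition u_seq :: "(real \<Rightarrow> real) \<Rightarrow> (real \<Rightarrow> real) \<Rightarrow> nat \<Rightarrow> real \<Rightarrow> real" where
  "u_seq \<phi> r n = deriv (r_seq \<phi> r n)"

definition v_seq :: "(real \<Rightarrow> real) \<Rightarrow> (real \<Rightarrow> real) \<Rightarrow> nat \<Rightarrow> real \<Rightarrow> real" where
  "v_seq \<phi> r n = (\<lambda>\<xi>. r_seq \<phi> r n \<xi> - \<xi> * deriv (r_seq \<phi> r n) \<xi>)"

definition pressure :: "real \<Rightarrow> real \<Rightarrow> real" where
  "pressure \<gamma> u = 1 / \<gamma> * u powr (- \<gamma>)"

(* The momentum equation v_t + p(u)_x = 0 reads -\<xi> v' + p(u)' = 0 for self-similar u, v.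
   The integral below is its weak form, tested with \<psi>, up to sign; the equation
   u_t - v_x = 0 holds for u_n and v_n by construction.
   The pressure is only defined for positive specific volume, whereas powr is total
   (for instance 0 powr (- \<gamma>) = 0), so positivity of u_n is required explicitly.
   As r_n is smooth and \<psi> has compact support, the integrand is then continuous with
   compact support, and the integral exists.  The case n = 0 is excluded, since
   scaled \<phi> 0 = 0.  The function y is only considered for t > 0. *)
definition self_similar_slic_solution :: "real \<Rightarrow> (real \<Rightarrow> real \<Rightarrow> real) \<Rightarrow> bool" where
  "self_similar_slic_solution \<gamma> y \<longleftrightarrow>
     (\<exists>r. L1_loc r \<and> (\<forall>x t. 0 < t \<longrightarrow> y x t = t * r (x / t)) \<and>
       (\<forall>\<phi>. mollifier \<phi> \<longrightarrow>
         (\<forall>n>0. \<forall>\<xi>. 0 < u_seq \<phi> r n \<xi>) \<and>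
         (\<forall>\<psi>. Cc1 \<psi> \<longrightarrow>
           (\<lambda>n. LINT \<xi>|lebesgue.
                 (pressure \<gamma> (u_seq \<phi> r n \<xi>) - \<xi> * v_seq \<phi> r n \<xi>) * deriv \<psi> \<xi>
                 - v_seq \<phi> r n \<xi> * \<psi> \<xi>) \<longlonglongrightarrow> 0)))"

end

(* Put \<alpha> = (\<gamma> - 1) / (\<gamma> + 1).  Up to its value at 0, the function r is the increasing function
   sgn x * (|x|^\<alpha> / \<alpha> + c) with c > 0, so u = r' is |x|^(\<alpha> - 1) plus a Dirac mass at 0.
   Difference quotients of r near x bound u_n(x) from below by (|x| + 2/n)^(\<alpha> - 1), which gives
   positivity and a bound for p(u_n), and from above by (|x| - 2/n)^(\<alpha> - 1) for |x| > 2/n.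
   Although u_n blows up near 0, x * u_n(x) stays bounded: |u_n| = O(n) on compact sets, and
   u_n(x) <= (|x| / 2)^(\<alpha> - 1) for |x| >= 4/n.  Hence dominated convergence applies, the Dirac mass
   is lost because of the factor x, and the pressure is continuous with value 0 at the cavity x = 0.
   The limit integrand is the derivative of (p(u) - x v) \<psi>, so its integral vanishes. *)
theory Submission
  imports Defs
begin

section \<open>Convolution of a monotone function with a kernel\<close>

text \<open>The derivative is the pointwise limit of difference quotients with step
  \<open>inverse (real (Suc i))\<close>, each Borel because \<open>F\<close> is continuous. This
  covers derivatives not known to be continuous, such as \<open>k'\<close> in the locale
  below.\<close>

lemma borel_measurable_derivative:
  fixes F F' :: "real \<Rightarrow> real"
  assumes "\<And>x. (F has_real_derivative F' x) (at x)"
  shows "F' \<in> borel_measurable borel"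
proof (rule borel_measurable_LIMSEQ_real)
  have "continuous_on UNIV F"
    using assms by (meson DERIV_isCont continuous_at_imp_continuous_on)
  then have [measurable]: "F \<in> borel_measurable borel"
    by (rule borel_measurable_continuous_onI)
  show "(\<lambda>x. (F (x + inverse (real (Suc i))) - F x) / inverse (real (Suc i))) \<in> borel_measurable borel" for i
    by measurable
  show "(\<lambda>i. (F (x + inverse (real (Suc i))) - F x) / inverse (real (Suc i))) \<longlonglongrightarrow> F' x" for x
  proof -
    have "filterlim (\<lambda>i. inverse (real (Suc i))) (at 0) sequentially"
      unfolding filterlim_at using LIMSEQ_inverse_real_of_nat by auto
    moreover have "((\<lambda>h. (F (x + h) - F x) / h) \<longlongrightarrow> F' x) (at 0)"
      using assms[of x] by (simp add: DERIV_def)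
    ultimately show ?thesis
      by (rule filterlim_compose[rotated])
  qed
qed

lemma integrable_const_indicator:
  "integrable lborel (\<lambda>x. B * indicator {a..b::real} x :: real)"
  by (intro integrable_mult_right integrable_real_indicator) (auto simp: emeasure_lborel_Icc_eq)

lemma integrable_bounded_support:
  fixes g :: "real \<Rightarrow> real"
  assumes "g \<in> borel_measurable borel" and "\<And>x. \<bar>g x\<bar> \<le> B * indicator {a..b} x"
  shows "integrable lborel g"
proof (rule Bochner_Integration.integrable_bound)
  show "integrable lborel (\<lambda>x. B * indicator {a..b} x :: real)"
    by (rule integrable_const_indicator)
  show "AE x in lborel. norm (g x) \<le> norm (B * indicator {a..b} x :: real)"
    using assms(2) by (intro AE_I2) (metis abs_ge_self order_trans real_norm_def)
qed (use assms in simp)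

lemma mono_abs_le:
  fixes f :: "real \<Rightarrow> real"
  assumes "mono f" and "a \<le> y" and "y \<le> b"
  shows "\<bar>f y\<bar> \<le> \<bar>f a\<bar> + \<bar>f b\<bar>"
  using monoD[OF assms(1,2)] monoD[OF assms(1,3)] by linarith

text \<open>Abstracts a rescaled mollifier. The radius \<delta> and the slope bound \<open>L\<close>
  are kept as explicit parameters because later estimates weigh them against each other: for
  \<delta> = 1/n the slope bound is of order n^2.\<close>

locale smoothing_kernel =
  fixes k k' :: "real \<Rightarrow> real" and \<delta> L :: real
  assumes radius_pos: "0 < \<delta>"
    and has_deriv: "(k has_real_derivative k' s) (at s)"
    and deriv_bound: "\<bar>k' s\<bar> \<le> L"
    and nonneg: "0 \<le> k s"
    and vanish: "\<delta> \<le> \<bar>s\<bar> \<Longrightarrow> k s = 0"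
    and mass: "(LBINT s. k s) = 1"
begin

section \<open>Regularity, boundedness and integrability of a kernel\<close>

lemma continuous_kernel: "continuous_on UNIV k"
  using has_deriv by (meson DERIV_isCont continuous_at_imp_continuous_on)

lemma measurable_kernel [measurable]: "k \<in> borel_measurable borel"
  by (rule borel_measurable_continuous_onI[OF continuous_kernel])

lemma measurable_kernel_deriv [measurable]: "k' \<in> borel_measurable borel"
  by (rule borel_measurable_derivative[OF has_deriv])

lemma L_nonneg: "0 \<le> L"
  using deriv_bound[of 0] by simp

lemma lipschitz: "\<bar>k a - k b\<bar> \<le> L * \<bar>a - b\<bar>"
proof -
  have "norm (k a - k b) \<le> L * norm (a - b)"
    by (rule field_differentiable_bound[where S=UNIV and f'=k'])
       (use has_deriv deriv_bound in auto)
  then show ?thesis by simp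
qed

lemma deriv_vanish:
  assumes "\<delta> < \<bar>s\<bar>"
  shows "k' s = 0"
proof -
  have "((\<lambda>_. 0) has_real_derivative k' s) (at s)"
  proof (rule has_field_derivative_transform_within_open[OF has_deriv])
    show "open {s. \<delta> < \<bar>s\<bar>}"
      by (intro open_Collect_less continuous_intros)
  qed (use assms vanish in auto)
  then show ?thesis
    by (rule DERIV_unique) simp
qed

lemma kernel_bounded: obtains B where "\<And>s. k s \<le> B"
proof -
  \<comment> \<open>The kernel vanishes at \<delta>, and every s with |s| < \<delta> is within
    2\<delta> of that point, so the Lipschitz bound controls the height.\<close>
  have "k s \<le> L * (2 * \<delta>)" for s
  proof (cases "\<delta> \<le> \<bar>s\<bar>")
    case True
    then show ?thesis using vanish L_nonneg radius_pos by simp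
  next
    case False
    then have "L * \<bar>s - \<delta>\<bar> \<le> L * (2 * \<delta>)"
      using L_nonneg by (intro mult_left_mono) auto
    then show ?thesis
      using lipschitz[of s \<delta>] vanish[of \<delta>] radius_pos by simp
  qed
  then show ?thesis by (rule that)
qed

lemma integrable_kernel: "integrable lborel k"
proof -
  obtain B where B: "\<And>s. k s \<le> B" using kernel_bounded by blast
  show ?thesis
    by (rule integrable_bounded_support[where B=B and a="-\<delta>" and b=\<delta>])
       (use B nonneg vanish in \<open>auto simp: indicator_def abs_le_iff\<close>)
qed

section \<open>Values and derivative of the convolution with a monotone function\<close>

lemma integrable_kernel_mono:
  assumes "mono f"
  shows "integrable lborel (\<lambda>s. k s * f (x - s))"
proof -
  obtain B where B: "\<And>s. k s \<le> B" using kernel_bounded by blast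
  have [measurable]: "f \<in> borel_measurable borel"
    using assms by (rule borel_measurable_mono)
  show ?thesis
  proof (rule integrable_bounded_support[where a="-\<delta>" and b=\<delta>])
    show "\<bar>k s * f (x - s)\<bar> \<le> (B * (\<bar>f (x - \<delta>)\<bar> + \<bar>f (x + \<delta>)\<bar>)) * indicator {-\<delta>..\<delta>} s" for s
    proof (cases "\<delta> \<le> \<bar>s\<bar>")
      case True
      then show ?thesis using vanish B[of s] nonneg[of s] by (auto simp: indicator_def)
    next
      case False
      then have "\<bar>f (x - s)\<bar> \<le> \<bar>f (x - \<delta>)\<bar> + \<bar>f (x + \<delta>)\<bar>"
        by (intro mono_abs_le[OF assms]) auto
      then have "k s * \<bar>f (x - s)\<bar> \<le> B * (\<bar>f (x - \<delta>)\<bar> + \<bar>f (x + \<delta>)\<bar>)"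
        using B[of s] nonneg[of s] by (intro mult_mono) auto
      then show ?thesis
        using False nonneg[of s] by (auto simp: abs_mult indicator_def)
    qed
  qed measurable
qed

lemma conv_eq_lborel:
  assumes [measurable]: "f \<in> borel_measurable borel"
  shows "conv k f x = (LBINT \<eta>. k (x - \<eta>) * f \<eta>)"
  unfolding conv_def by (rule integral_completion) measurable

lemma conv_eq:
  assumes "mono f"
  shows "conv k f x = (LBINT s. k s * f (x - s))"
proof -
  have [measurable]: "f \<in> borel_measurable borel"
    using assms by (rule borel_measurable_mono)
  show ?thesis
    unfolding conv_eq_lborel[OF borel_measurable_mono[OF assms]]
    by (subst lborel_integral_real_affine[where c="-1" and t=x]) auto
qed

text \<open>The kernel is a probability density carried by [-\<delta>, \<delta>], so the convolution
  is an average of values of \<open>f\<close> at points between x - \<delta> and x +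
  \<delta>.\<close>

lemma conv_between:
  assumes "mono f"
  shows "f (x - \<delta>) \<le> conv k f x" and "conv k f x \<le> f (x + \<delta>)"
proof -
  have "(LBINT s. k s * f (x - \<delta>)) \<le> (LBINT s. k s * f (x - s))"
  proof (rule integral_mono[OF _ integrable_kernel_mono[OF assms]])
    show "k s * f (x - \<delta>) \<le> k s * f (x - s)" for s
      using vanish[of s] nonneg[of s] monoD[OF assms, of "x - \<delta>" "x - s"]
      by (cases "\<delta> \<le> \<bar>s\<bar>") (auto intro!: mult_left_mono)
  qed (use integrable_kernel in simp)
  then show "f (x - \<delta>) \<le> conv k f x"
    using mass by (simp add: conv_eq[OF assms])
  have "(LBINT s. k s * f (x - s)) \<le> (LBINT s. k s * f (x + \<delta>))"
  proof (rule integral_mono[OF integrable_kernel_mono[OF assms]])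
    show "k s * f (x - s) \<le> k s * f (x + \<delta>)" for s
      using vanish[of s] nonneg[of s] monoD[OF assms, of "x - s" "x + \<delta>"]
      by (cases "\<delta> \<le> \<bar>s\<bar>") (auto intro!: mult_left_mono)
  qed (use integrable_kernel in simp)
  then show "conv k f x \<le> f (x + \<delta>)"
    using mass by (simp add: conv_eq[OF assms])
qed

text \<open>Differentiation under the integral. The derivative falls on the kernel, because
  \<open>f\<close> may jump. Working along sequences of nonzero steps makes dominated convergence
  available.\<close>

lemma conv_has_derivative:
  assumes "mono f"
  shows "(conv k f has_real_derivative (LBINT \<eta>. k' (x - \<eta>) * f \<eta>)) (at x)"
  unfolding DERIV_def tendsto_at_iff_sequentially comp_def
proof (intro allI impI)
  fix h :: "nat \<Rightarrow> real"
  assume nz: "\<forall>i. h i \<in> UNIV - {0}" and lim: "h \<longlonglongrightarrow> 0"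
  have fm [measurable]: "f \<in> borel_measurable borel"
    using assms by (rule borel_measurable_mono)
  obtain H where H: "\<And>i. \<bar>h i\<bar> \<le> H"
    using convergent_imp_Bseq[of h] lim unfolding convergent_def Bseq_def by auto
  have H0: "0 \<le> H" using H[of 0] by linarith
  obtain B where B: "\<And>s. k s \<le> B" using kernel_bounded by blast
  define R where "R = \<bar>f (x - (\<delta> + H))\<bar> + \<bar>f (x + (\<delta> + H))\<bar>"
  have R: "\<bar>f y\<bar> \<le> R" if "\<bar>x - y\<bar> \<le> \<delta> + H" for y
    unfolding R_def by (rule mono_abs_le[OF assms]) (use that in auto)
  let ?I = "indicator {x - (\<delta> + H)..x + (\<delta> + H)} :: real \<Rightarrow> real"
  \<comment> \<open>The Lipschitz bound supplies a factor |t|, and for \<eta> farther than \<delta>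
    + H from x both kernel values vanish. After division by the step the majorant is therefore
    independent of it.\<close>
  have bnd: "\<bar>(k (x + t - \<eta>) - k (x - \<eta>)) * f \<eta>\<bar> \<le> L * \<bar>t\<bar> * R * ?I \<eta>"
    if t: "\<bar>t\<bar> \<le> H" for t \<eta>
  proof (cases "\<bar>x - \<eta>\<bar> \<le> \<delta> + H")
    case True
    have "\<bar>k (x + t - \<eta>) - k (x - \<eta>)\<bar> * \<bar>f \<eta>\<bar> \<le> (L * \<bar>t\<bar>) * R"
      using lipschitz[of "x + t - \<eta>" "x - \<eta>"] R[OF True] L_nonneg
      by (intro mult_mono) auto
    then show ?thesis using True by (auto simp: abs_mult indicator_def)
  next
    case False
    then have "\<delta> \<le> \<bar>x - \<eta>\<bar>" "\<delta> \<le> \<bar>x + t - \<eta>\<bar>" using t H0 by linarith+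
    then show ?thesis using False by (auto simp: vanish indicator_def)
  qed
  have int0: "integrable lborel (\<lambda>\<eta>. k (z - \<eta>) * f \<eta>)" for z
  proof -
    have "integrable lborel (\<lambda>s. k s * f (z - s))"
      by (rule integrable_kernel_mono[OF assms])
    from lborel_integrable_real_affine[OF this, of "-1" z] show ?thesis by simp
  qed
  have quot: "(conv k f (x + h i) - conv k f x) / h i
      = (LBINT \<eta>. (k (x + h i - \<eta>) - k (x - \<eta>)) * f \<eta> / h i)" for i
    unfolding conv_eq_lborel[OF fm]
    by (subst Bochner_Integration.integral_diff[OF int0 int0, symmetric])
       (simp add: algebra_simps)
  show "(\<lambda>i. (conv k f (x + h i) - conv k f x) / h i) \<longlonglongrightarrow> (LBINT \<eta>. k' (x - \<eta>) * f \<eta>)"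
    unfolding quot
  proof (rule integral_dominated_convergence[where w="\<lambda>\<eta>. L * R * ?I \<eta>"])
    show "integrable lborel (\<lambda>\<eta>. L * R * ?I \<eta>)"
      by (rule integrable_const_indicator)
    show "AE \<eta> in lborel. norm ((k (x + h i - \<eta>) - k (x - \<eta>)) * f \<eta> / h i) \<le> L * R * ?I \<eta>" for i
    proof (rule AE_I2)
      fix \<eta>
      have "h i \<noteq> 0" using nz by auto
      then show "norm ((k (x + h i - \<eta>) - k (x - \<eta>)) * f \<eta> / h i) \<le> L * R * ?I \<eta>"
        using bnd[OF H[of i], of \<eta>] by (simp add: abs_mult divide_simps ac_simps)
    qed
    show "AE \<eta> in lborel. (\<lambda>i. (k (x + h i - \<eta>) - k (x - \<eta>)) * f \<eta> / h i) \<longlonglongrightarrow> k' (x - \<eta>) * f \<eta>"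
    proof (rule AE_I2)
      fix \<eta>
      have "((\<lambda>t. (k (x - \<eta> + t) - k (x - \<eta>)) / t) \<longlongrightarrow> k' (x - \<eta>)) (at 0)"
        using has_deriv[of "x - \<eta>"] by (simp add: DERIV_def)
      moreover have "filterlim h (at 0) sequentially"
        unfolding filterlim_at using lim nz by auto
      ultimately have "(\<lambda>i. (k (x - \<eta> + h i) - k (x - \<eta>)) / h i) \<longlonglongrightarrow> k' (x - \<eta>)"
        by (rule filterlim_compose)
      from tendsto_mult_right[OF this, of "f \<eta>"]
      show "(\<lambda>i. (k (x + h i - \<eta>) - k (x - \<eta>)) * f \<eta> / h i) \<longlonglongrightarrow> k' (x - \<eta>) * f \<eta>"
        by (simp add: algebra_simps)
    qed
  qed measurable
qed

text \<open>The integrand in the derivative formula is at most \<open>L * R\<close> and lives on an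
  interval of length 2\<delta>. This crude bound serves near a jump of \<open>f\<close>, where no
  upper bound on its slopes is available.\<close>

lemma deriv_conv_abs_le:
  assumes "mono f" and R: "\<And>y. \<bar>x - y\<bar> \<le> \<delta> \<Longrightarrow> \<bar>f y\<bar> \<le> R"
  shows "\<bar>deriv (conv k f) x\<bar> \<le> 2 * \<delta> * L * R"
proof -
  let ?I = "indicator {x - \<delta>..x + \<delta>} :: real \<Rightarrow> real"
  have [measurable]: "f \<in> borel_measurable borel"
    using assms(1) by (rule borel_measurable_mono)
  have "norm (LBINT \<eta>. k' (x - \<eta>) * f \<eta>) \<le> (LBINT \<eta>. L * R * ?I \<eta>)"
  proof (rule Bochner_Integration.integral_norm_bound_integral)
    have "\<bar>k' (x - \<eta>) * f \<eta>\<bar> \<le> L * R * ?I \<eta>" for \<eta>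
    proof (cases "\<bar>x - \<eta>\<bar> \<le> \<delta>")
      case True
      have "\<bar>k' (x - \<eta>)\<bar> * \<bar>f \<eta>\<bar> \<le> L * R"
        using deriv_bound R[OF True] L_nonneg by (intro mult_mono) auto
      then show ?thesis using True by (auto simp: abs_mult indicator_def)
    next
      case False
      then show ?thesis by (auto simp: deriv_vanish indicator_def)
    qed
    then show "integrable lborel (\<lambda>\<eta>. k' (x - \<eta>) * f \<eta>)"
      and "\<And>\<eta>. norm (k' (x - \<eta>) * f \<eta>) \<le> L * R * ?I \<eta>"
      by (auto intro!: integrable_bounded_support)
  qed (rule integrable_const_indicator)
  also have "\<dots> = 2 * \<delta> * L * R"
    using radius_pos by simp
  finally show ?thesis
    by (simp add: DERIV_imp_deriv[OF conv_has_derivative[OF assms(1)]])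
qed

lemma conv_has_deriv:
  assumes "mono f"
  shows "(conv k f has_real_derivative deriv (conv k f) x) (at x)"
  using conv_has_derivative[OF assms, of x]
  by (simp add: DERIV_imp_deriv[OF conv_has_derivative[OF assms]])

section \<open>Bounds on the derivative of the convolution from increments of the function\<close>

lemma conv_increment:
  assumes "mono f"
  shows "conv k f (x + h) - conv k f x = (LBINT s. k s * (f (x + h - s) - f (x - s)))"
    and "integrable lborel (\<lambda>s. k s * (f (x + h - s) - f (x - s)))"
  using Bochner_Integration.integral_diff[OF integrable_kernel_mono integrable_kernel_mono, OF assms assms, of "x + h" x]
    Bochner_Integration.integrable_diff[OF integrable_kernel_mono integrable_kernel_mono, OF assms assms, of "x + h" x]
  by (simp_all only: conv_eq[OF assms] right_diff_distrib)

lemma quotient_at_right: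
  assumes "mono f"
  shows "((\<lambda>h. (conv k f (x + h) - conv k f x) / h) \<longlongrightarrow> deriv (conv k f) x) (at_right 0)"
  using conv_has_deriv[OF assms, of x] unfolding DERIV_def
  by (rule tendsto_within_subset) simp

text \<open>For 0 < h < \<delta> and |s| < \<delta> the points x - s and x + h - s lie within
  2\<delta> of x, so the increment of the convolution is an average of increments of
  \<open>f\<close>, each at least m * h. Dividing by h and letting h tend to 0 from the right gives
  the bound, even across a jump of \<open>f\<close>.\<close>

lemma deriv_conv_ge:
  assumes "mono f"
    and incr: "\<And>a b. \<lbrakk>x - 2 * \<delta> \<le> a; a \<le> b; b \<le> x + 2 * \<delta>\<rbrakk> \<Longrightarrow> m * (b - a) \<le> f b - f a"
  shows "m \<le> deriv (conv k f) x"
proof (rule tendsto_lowerbound[OF quotient_at_right[OF assms(1)]])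
  have "m \<le> (conv k f (x + h) - conv k f x) / h" if h: "0 < h" "h < \<delta>" for h
  proof -
    have "(LBINT s. k s * (m * h)) \<le> (LBINT s. k s * (f (x + h - s) - f (x - s)))"
    proof (rule integral_mono[OF _ conv_increment(2)[OF assms(1)]])
      show "k s * (m * h) \<le> k s * (f (x + h - s) - f (x - s))" for s
        using vanish[of s] nonneg[of s] incr[of "x - s" "x + h - s"] h
        by (cases "\<delta> \<le> \<bar>s\<bar>") (auto intro!: mult_left_mono)
    qed (use integrable_kernel in simp)
    then have "m * h \<le> conv k f (x + h) - conv k f x"
      using mass by (simp add: conv_increment(1)[OF assms(1)])
    then show ?thesis using h by (simp add: field_simps)
  qed
  then show "\<forall>\<^sub>F h in at_right 0. m \<le> (conv k f (x + h) - conv k f x) / h"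
    using radius_pos by (auto simp: eventually_at_right)
qed simp

lemma deriv_conv_le:
  assumes "mono f"
    and incr: "\<And>a b. \<lbrakk>x - 2 * \<delta> \<le> a; a \<le> b; b \<le> x + 2 * \<delta>\<rbrakk> \<Longrightarrow> f b - f a \<le> m * (b - a)"
  shows "deriv (conv k f) x \<le> m"
proof (rule tendsto_upperbound[OF quotient_at_right[OF assms(1)]])
  have "(conv k f (x + h) - conv k f x) / h \<le> m" if h: "0 < h" "h < \<delta>" for h
  proof -
    have "(LBINT s. k s * (f (x + h - s) - f (x - s))) \<le> (LBINT s. k s * (m * h))"
    proof (rule integral_mono[OF conv_increment(2)[OF assms(1)]])
      show "k s * (f (x + h - s) - f (x - s)) \<le> k s * (m * h)" for s
        using vanish[of s] nonneg[of s] incr[of "x - s" "x + h - s"] h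
        by (cases "\<delta> \<le> \<bar>s\<bar>") (auto intro!: mult_left_mono)
    qed (use integrable_kernel in simp)
    then have "conv k f (x + h) - conv k f x \<le> m * h"
      using mass by (simp add: conv_increment(1)[OF assms(1)])
    then show ?thesis using h by (simp add: field_simps)
  qed
  then show "\<forall>\<^sub>F h in at_right 0. (conv k f (x + h) - conv k f x) / h \<le> m"
    using radius_pos by (auto simp: eventually_at_right)
qed simp

end

section \<open>Supports, and mollifiers as kernels\<close>

lemma supp_vanish: "x \<notin> supp f \<Longrightarrow> f x = 0"
  unfolding supp_def using subsetD[OF closure_subset[of "{x. f x \<noteq> 0}"], of x] by auto

lemma bounded_of_compact_supp:
  assumes "compact (supp f)" and "continuous_on UNIV f"
  shows "\<exists>M. \<forall>x. \<bar>f x\<bar> \<le> M"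
proof -
  have "compact (f ` supp f)"
    using assms(1) by (intro compact_continuous_image continuous_on_subset[OF assms(2) subset_UNIV])
  then obtain M where M: "\<forall>x\<in>supp f. \<bar>f x\<bar> \<le> M"
    using compact_imp_bounded[of "f ` supp f"] by (auto simp: bounded_iff)
  have "\<bar>f x\<bar> \<le> max M 0" for x
    using bspec[OF M, of x] supp_vanish[of x f] by (cases "x \<in> supp f") auto
  then show ?thesis by blast
qed

text \<open>The support is closed, so off it the function vanishes on a whole neighbourhood and has
  derivative 0.\<close>

lemma supp_deriv_subset:
  fixes f :: "real \<Rightarrow> real"
  shows "supp (deriv f) \<subseteq> supp f"
proof -
  have "deriv f x = 0" if "x \<notin> supp f" for x
  proof (rule DERIV_imp_deriv)
    have "open (- supp f)" unfolding supp_def by (intro open_Compl closed_closure)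
    then show "(f has_real_derivative 0) (at x)"
      by (rule has_field_derivative_transform_within_open[where f="\<lambda>_. 0", rotated])
         (use that in \<open>simp_all add: supp_vanish\<close>)
  qed
  then have "{x. deriv f x \<noteq> 0} \<subseteq> supp f" by auto
  then show ?thesis
    unfolding supp_def[of "deriv f"] by (rule closure_minimal) (simp add: supp_def)
qed

lemma compact_supp_deriv:
  fixes f :: "real \<Rightarrow> real"
  assumes "compact (supp f)"
  shows "compact (supp (deriv f))"
  using compact_Int_closed[OF assms, of "supp (deriv f)"] supp_deriv_subset[of f]
  by (simp add: supp_def Int_absorb1)

text \<open>A single bound M for |\<phi>'| serves every n, since the chain rule multiplies the slope
  by n^2 while the radius shrinks to 1/n. With \<open>deriv_conv_abs_le\<close> this yields the
  growth O(n) of u_n on compact sets.\<close>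

lemma mollifier_kernel:
  assumes "mollifier \<phi>"
  obtains M where "\<And>n. 0 < n \<Longrightarrow>
    smoothing_kernel (scaled \<phi> n) (\<lambda>s. real n ^ 2 * deriv \<phi> (real n * s)) (1 / real n) (real n ^ 2 * M)"
proof -
  have smooth: "(deriv ^^ j) \<phi> differentiable_on UNIV" for j
    using assms unfolding mollifier_def Cc_infinity_def by blast
  have cs: "compact (supp \<phi>)" and sub: "supp \<phi> \<subseteq> {-1<..<1}"
    and nn: "\<And>x. 0 \<le> \<phi> x" and one: "(LINT x|lebesgue. \<phi> x) = 1"
    using assms unfolding mollifier_def Cc_infinity_def by auto
  have d\<phi>: "(\<phi> has_real_derivative deriv \<phi> s) (at s)" for s
    using smooth[of 0] DERIV_deriv_iff_real_differentiable
    by (auto simp: differentiable_on_def)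
  have "continuous_on UNIV (deriv \<phi>)"
    using smooth[of 1] by (intro differentiable_imp_continuous_on) simp
  moreover have "compact (supp (deriv \<phi>))"
    by (rule compact_supp_deriv[OF cs])
  ultimately obtain M where M: "\<And>x. \<bar>deriv \<phi> x\<bar> \<le> M"
    using bounded_of_compact_supp[of "deriv \<phi>"] by auto
  have [measurable]: "\<phi> \<in> borel_measurable borel"
    using d\<phi>[THEN DERIV_isCont]
    by (intro borel_measurable_continuous_onI continuous_at_imp_continuous_on) auto
  have "smoothing_kernel (scaled \<phi> n) (\<lambda>s. real n ^ 2 * deriv \<phi> (real n * s)) (1 / real n) (real n ^ 2 * M)"
    if n: "0 < n" for n
  proof
    show "0 < 1 / real n" using n by simp
    show "(scaled \<phi> n has_real_derivative real n ^ 2 * deriv \<phi> (real n * s)) (at s)" for s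
      unfolding scaled_def
      by (rule derivative_eq_intros DERIV_chain2[OF d\<phi>] refl)+ (simp add: power2_eq_square)
    show "\<bar>real n ^ 2 * deriv \<phi> (real n * s)\<bar> \<le> real n ^ 2 * M" for s
      using M by (simp add: abs_mult mult_left_mono)
    show "0 \<le> scaled \<phi> n s" for s
      using nn by (simp add: scaled_def)
    show "scaled \<phi> n s = 0" if "1 / real n \<le> \<bar>s\<bar>" for s
    proof -
      \<comment> \<open>The support lies in the open interval, so the boundary case |n s| = 1 is
        already outside it.\<close>
      have "1 \<le> \<bar>real n * s\<bar>"
        using that n by (simp add: field_simps abs_mult)
      then have "real n * s \<notin> supp \<phi>" using sub by (auto simp: abs_if split: if_splits)
      then show ?thesis by (simp add: scaled_def supp_vanish)
    qed
    have "(LBINT x. \<phi> x) = 1"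
      using one by (subst (asm) integral_completion) auto
    then show "(LBINT s. scaled \<phi> n s) = 1"
      using n by (subst (asm) lborel_integral_real_affine[where c="real n" and t=0])
        (auto simp: scaled_def)
  qed
  then show ?thesis by (rule that)
qed

section \<open>The limit profile\<close>

text \<open>The points on the same side of 0 as x form a neighbourhood on which \<open>sgn\<close>
  is constant; this treats both half-lines at once when differentiating expressions in |x| and
  \<open>sgn x\<close>.\<close>

lemma same_sign_open:
  fixes x :: real
  assumes "x \<noteq> 0"
  shows "open {y. 0 < y * x}" and "x \<in> {y. 0 < y * x}"
proof -
  show "open {y. 0 < y * x}" by (intro open_Collect_less continuous_intros)
  show "x \<in> {y. 0 < y * x}" using assms by (auto simp: zero_less_mult_iff)
qed

lemma abs_powr_has_derivative:
  fixes x :: real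
  assumes "x \<noteq> 0"
  shows "((\<lambda>y. \<bar>y\<bar> powr p) has_real_derivative sgn x * (p * \<bar>x\<bar> powr (p - 1))) (at x)"
proof (rule has_field_derivative_transform_within_open[OF _ same_sign_open[OF assms]])
  have "0 < sgn x * x"
    using assms by (simp add: sgn_if)
  then have "((\<lambda>y. (sgn x * y) powr p) has_real_derivative
      p * (sgn x * x) powr (p - 1) * sgn x) (at x)"
    by (intro DERIV_chain2[OF has_real_derivative_powr])
       (auto intro!: derivative_eq_intros)
  then show "((\<lambda>y. (sgn x * y) powr p) has_real_derivative
      sgn x * (p * \<bar>x\<bar> powr (p - 1))) (at x)"
    by (simp add: abs_sgn ac_simps)
  show "(sgn x * y) powr p = \<bar>y\<bar> powr p" if "y \<in> {y. 0 < y * x}" for y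
    using that by (auto simp: sgn_if zero_less_mult_iff)
qed

text \<open>In the application \<alpha> = (\<gamma> - 1) / (\<gamma> + 1) and c = -2w / (\<gamma> -
  1). The sign of c makes the jump at 0, of height 2c, go upwards.\<close>

locale power_profile =
  fixes \<alpha> c :: real
  assumes \<alpha>_pos: "0 < \<alpha>" and \<alpha>_less: "\<alpha> < 1" and c_nonneg: "0 \<le> c"
begin

text \<open>As \<open>sgn 0 = 0\<close>, the value at 0 is the midpoint of the jump, which makes the
  profile odd on the whole line.\<close>

definition profile :: "real \<Rightarrow> real" where
  "profile x = sgn x * (\<bar>x\<bar> powr \<alpha> / \<alpha> + c)"

lemma profile_minus: "profile (- x) = - profile x"
  by (simp add: profile_def sgn_minus)

lemma profile_has_derivative:
  assumes "x \<noteq> 0"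
  shows "(profile has_real_derivative \<bar>x\<bar> powr (\<alpha> - 1)) (at x)"
proof (rule has_field_derivative_transform_within_open[OF _ same_sign_open[OF assms]])
  have "((\<lambda>y. sgn x * (\<bar>y\<bar> powr \<alpha> / \<alpha> + c)) has_real_derivative
      sgn x * (sgn x * (\<alpha> * \<bar>x\<bar> powr (\<alpha> - 1)) / \<alpha> + 0)) (at x)"
    by (intro DERIV_cmult DERIV_add DERIV_cdivide abs_powr_has_derivative[OF assms] DERIV_const)
  then show "((\<lambda>y. sgn x * (\<bar>y\<bar> powr \<alpha> / \<alpha> + c)) has_real_derivative \<bar>x\<bar> powr (\<alpha> - 1)) (at x)"
    using assms \<alpha>_pos by (simp add: sgn_if split: if_splits)
  show "sgn x * (\<bar>y\<bar> powr \<alpha> / \<alpha> + c) = profile y" if "y \<in> {y. 0 < y * x}" for y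
    using that by (auto simp: profile_def sgn_if zero_less_mult_iff)
qed

text \<open>On (0, K] the slope |x|^(\<alpha> - 1) is at least K^(\<alpha> - 1), because the
  exponent is negative, and the mean value theorem applies. At a = 0 a jump may intervene; there
  b^\<alpha> = b * b^(\<alpha> - 1) together with 1/\<alpha> > 1 and c >= 0 gives the estimate
  directly.\<close>

lemma profile_increment_ge_nonneg:
  assumes "0 \<le> a" "a \<le> b" "b \<le> K" "0 < K"
  shows "K powr (\<alpha> - 1) * (b - a) \<le> profile b - profile a"
proof -
  consider "a = b" | "a = 0" "0 < b" | "0 < a" "a < b" using assms by linarith
  then show ?thesis
  proof cases
    case 1
    then show ?thesis by simp
  next
    case 2
    have "K powr (\<alpha> - 1) * b \<le> b powr (\<alpha> - 1) * b"
      using 2 assms \<alpha>_less by (intro mult_right_mono powr_mono2') auto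
    also have "\<dots> = b powr \<alpha>"
      using 2 powr_add[of b "\<alpha> - 1" 1] by simp
    also have "\<dots> \<le> b powr \<alpha> / \<alpha>"
      using \<alpha>_pos \<alpha>_less mult_left_le[of \<alpha> "b powr \<alpha>"] by (simp add: field_simps)
    also have "\<dots> \<le> b powr \<alpha> / \<alpha> + c"
      using c_nonneg by simp
    finally show ?thesis using 2 by (simp add: profile_def)
  next
    case 3
    have "(profile has_real_derivative \<bar>y\<bar> powr (\<alpha> - 1)) (at y)" if "a \<le> y" "y \<le> b" for y
      using profile_has_derivative[of y] that 3 by simp
    then obtain z where z: "a < z" "z < b" "profile b - profile a = (b - a) * \<bar>z\<bar> powr (\<alpha> - 1)"
      using MVT2[OF 3(2), of profile "\<lambda>x. \<bar>x\<bar> powr (\<alpha> - 1)"] by blast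
    have "K powr (\<alpha> - 1) \<le> \<bar>z\<bar> powr (\<alpha> - 1)"
      using z 3 assms \<alpha>_less by (intro powr_mono2') auto
    then show ?thesis using z 3 by (simp add: mult.commute mult_left_mono)
  qed
qed

text \<open>Oddness reflects the estimate to the negative half-line, and an increment straddling 0
  is split there.\<close>

lemma profile_increment_ge:
  assumes "a \<le> b" "\<bar>a\<bar> \<le> K" "\<bar>b\<bar> \<le> K" "0 < K"
  shows "K powr (\<alpha> - 1) * (b - a) \<le> profile b - profile a"
proof -
  consider "0 \<le> a" | "b \<le> 0" | "a < 0" "0 < b" by linarith
  then show ?thesis
  proof cases
    case 1
    then show ?thesis using profile_increment_ge_nonneg[of a b K] assms by simp
  next
    case 2
    then show ?thesis
      using profile_increment_ge_nonneg[of "-b" "-a" K] assms by (simp add: profile_minus)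
  next
    case 3
    then show ?thesis
      using profile_increment_ge_nonneg[of 0 b K] profile_increment_ge_nonneg[of 0 "-a" K] assms
      by (simp add: profile_minus profile_def[of 0] algebra_simps)
  qed
qed

lemma mono_profile: "mono profile"
proof
  fix a b :: real
  assume "a \<le> b"
  \<comment> \<open>The summand 1 keeps the bound on |a| and |b| positive when both are 0.\<close>
  then have "(\<bar>a\<bar> + \<bar>b\<bar> + 1) powr (\<alpha> - 1) * (b - a) \<le> profile b - profile a"
    by (intro profile_increment_ge) auto
  moreover have "0 \<le> (\<bar>a\<bar> + \<bar>b\<bar> + 1) powr (\<alpha> - 1) * (b - a)"
    using \<open>a \<le> b\<close> by simp
  ultimately show "profile a \<le> profile b" by linarith
qed

lemma measurable_profile [measurable]: "profile \<in> borel_measurable borel"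
  by (rule borel_measurable_mono[OF mono_profile])

text \<open>Distance m from 0 excludes the jump, so the mean value theorem applies, and the slope is
  a decreasing function of |x|.\<close>

lemma profile_increment_le:
  assumes "0 < m" "a \<le> b" and away: "\<And>y. \<lbrakk>a \<le> y; y \<le> b\<rbrakk> \<Longrightarrow> m \<le> \<bar>y\<bar>"
  shows "profile b - profile a \<le> m powr (\<alpha> - 1) * (b - a)"
proof (cases "a = b")
  case False
  then have "a < b" using assms by simp
  have "(profile has_real_derivative \<bar>y\<bar> powr (\<alpha> - 1)) (at y)" if "a \<le> y" "y \<le> b" for y
    using profile_has_derivative[of y] away[OF that] assms(1) by fastforce
  then obtain z where z: "a < z" "z < b" "profile b - profile a = (b - a) * \<bar>z\<bar> powr (\<alpha> - 1)"
    using MVT2[OF \<open>a < b\<close>, of profile "\<lambda>x. \<bar>x\<bar> powr (\<alpha> - 1)"] by blast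
  have "\<bar>z\<bar> powr (\<alpha> - 1) \<le> m powr (\<alpha> - 1)"
    using z away[of z] assms \<alpha>_less by (intro powr_mono2') auto
  then show ?thesis using z assms by (simp add: mult.commute mult_left_mono)
qed simp

section \<open>Velocity and flux of the limit, without the Dirac mass at 0\<close>

definition velocity :: "real \<Rightarrow> real" where
  "velocity x = profile x - x * \<bar>x\<bar> powr (\<alpha> - 1)"

lemma measurable_velocity [measurable]: "velocity \<in> borel_measurable borel"
  unfolding velocity_def by measurable

text \<open>The coefficient \<open>(1 - \<alpha>) / (1 + \<alpha>)\<close> is \<open>1 / \<gamma>\<close>, so the first summand is the pressure of
  \<open>u = \<bar>x\<bar> powr (\<alpha> - 1)\<close>.\<close>

definition flux :: "real \<Rightarrow> real" where
  "flux x = (1 - \<alpha>) / (1 + \<alpha>) * \<bar>x\<bar> powr (1 + \<alpha>) - x * velocity x"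

lemma velocity_eq:
  "velocity x = sgn x * ((1 / \<alpha> - 1) * \<bar>x\<bar> powr \<alpha> + c)"
proof (cases "x = 0")
  case False
  then have "x * \<bar>x\<bar> powr (\<alpha> - 1) = sgn x * \<bar>x\<bar> powr \<alpha>"
    using powr_add[of "\<bar>x\<bar>" 1 "\<alpha> - 1"] mult_sgn_abs[of x] by (metis add.commute diff_add_cancel
      abs_ge_zero mult.assoc powr_one)
  then show ?thesis by (simp add: velocity_def profile_def algebra_simps)
qed (simp add: velocity_def profile_def)

text \<open>Since x * sgn x = |x|, the factor x turns the jump of \<open>velocity\<close> at 0 into
  the kink -c |x|. Continuity of the flux at 0 can be read off from this form.\<close>

lemma flux_eq:
  "flux x = ((1 - \<alpha>) / (1 + \<alpha>) - (1 / \<alpha> - 1)) * \<bar>x\<bar> powr (1 + \<alpha>) - c * \<bar>x\<bar>"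
proof (cases "x = 0")
  case False
  have "x * velocity x = (x * sgn x) * ((1 / \<alpha> - 1) * \<bar>x\<bar> powr \<alpha> + c)"
    by (simp add: velocity_eq)
  also have "\<dots> = (1 / \<alpha> - 1) * \<bar>x\<bar> powr (1 + \<alpha>) + c * \<bar>x\<bar>"
    using False by (simp only: abs_sgn[symmetric]) (simp add: powr_add algebra_simps)
  finally have "x * velocity x = \<dots>" .
  then show ?thesis by (simp add: flux_def algebra_simps)
qed (simp add: flux_def)

lemma continuous_flux: "continuous_on UNIV flux"
  unfolding flux_eq[abs_def] using \<alpha>_pos
  by (intro continuous_intros continuous_on_powr') auto

text \<open>This is the momentum equation -x v' + p(u)' = 0 rewritten as (p(u) - x v)' = -v.\<close>

lemma flux_has_derivative:
  assumes "x \<noteq> 0"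
  shows "(flux has_real_derivative - velocity x) (at x)"
proof -
  let ?A = "(1 - \<alpha>) / (1 + \<alpha>) - (1 / \<alpha> - 1)"
  have "((\<lambda>x. \<bar>x\<bar> powr 1) has_real_derivative sgn x * (1 * \<bar>x\<bar> powr (1 - 1))) (at x)"
    by (rule abs_powr_has_derivative[OF assms])
  then have abs: "(abs has_real_derivative sgn x) (at x)"
    using assms by simp
  have "(flux has_real_derivative
      ?A * (sgn x * ((1 + \<alpha>) * \<bar>x\<bar> powr (1 + \<alpha> - 1))) - c * sgn x) (at x)"
    unfolding flux_eq[abs_def]
    by (intro DERIV_diff DERIV_cmult abs_powr_has_derivative[OF assms] abs)
  \<comment> \<open>The value (1 - \<alpha>) / (1 + \<alpha>) of 1/\<gamma> enters here: with it the
    coefficients of |x|^\<alpha> on both sides agree.\<close>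
  moreover have "?A * (1 + \<alpha>) = - (1 / \<alpha> - 1)"
  proof -
    have "?A * (1 + \<alpha>) = (1 - \<alpha>) - (1 / \<alpha> - 1) * (1 + \<alpha>)"
      using \<alpha>_pos by (subst left_diff_distrib) simp
    then show ?thesis using \<alpha>_pos by (simp add: field_simps)
  qed
  moreover have "A * (s * (B * p)) - c * s = s * ((A * B) * p - c)" for A B s p :: real
    by (simp add: algebra_simps)
  ultimately have "(flux has_real_derivative sgn x * (- (1 / \<alpha> - 1) * \<bar>x\<bar> powr (1 + \<alpha> - 1) - c)) (at x)"
    by simp
  then show ?thesis by (simp add: velocity_eq algebra_simps)
qed

section \<open>Bounds on the derivative of the mollified profile\<close>

lemma deriv_conv_profile_ge:
  assumes "smoothing_kernel k k' \<delta> L" and "\<bar>x\<bar> + 2 * \<delta> \<le> K"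
  shows "K powr (\<alpha> - 1) \<le> deriv (conv k profile) x"
proof -
  interpret smoothing_kernel k k' \<delta> L by fact
  \<comment> \<open>All points within 2\<delta> of x have modulus at most K, so the lower bound on
    increments holds on the whole window, across 0 as well.\<close>
  show ?thesis
    by (rule deriv_conv_ge[OF mono_profile], rule profile_increment_ge)
       (use assms(2) radius_pos in auto)
qed

lemma deriv_conv_profile_le:
  assumes "smoothing_kernel k k' \<delta> L" and "0 < m" and "m + 2 * \<delta> \<le> \<bar>x\<bar>"
  shows "deriv (conv k profile) x \<le> m powr (\<alpha> - 1)"
proof -
  interpret smoothing_kernel k k' \<delta> L by fact
  show ?thesis
    by (rule deriv_conv_le[OF mono_profile], rule profile_increment_le)
       (use assms(2,3) radius_pos in auto)
qed

text \<open>Two regimes meet at |x| = 4/n. Inside, the growth O(n) of the derivative is compensated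
  by |x| <= 4/n; outside, the slope bound at |x|/2 gives a multiple of (|x|/2)^\<alpha>. The result
  is uniform in n, as a majorant requires.\<close>

lemma weighted_deriv_conv_profile_bound:
  assumes "0 < n" and "smoothing_kernel k k' (1 / real n) (real n ^ 2 * M)"
    and "\<bar>x\<bar> \<le> K"
  shows "\<bar>x * deriv (conv k profile) x\<bar> \<le> 8 * (M * profile (K + 1)) + 2 * K powr \<alpha>"
proof -
  interpret smoothing_kernel k k' "1 / real n" "real n ^ 2 * M" by fact
  have n1: "1 \<le> real n" using assms(1) by simp
  have d1: "1 / real n \<le> 1" using n1 by simp
  have R: "\<bar>profile y\<bar> \<le> profile (K + 1)" if "\<bar>x - y\<bar> \<le> 1 / real n" for y
  proof -
    have "\<bar>y\<bar> \<le> K + 1" using that d1 assms(3) by linarith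
    then have "profile y \<le> profile (K + 1)" "profile (- (K + 1)) \<le> profile y"
      by (intro monoD[OF mono_profile]; simp)+
    then show ?thesis using profile_minus[of "K + 1"] by linarith
  qed
  have R0: "0 \<le> profile (K + 1)" using R[of x] n1 by simp
  have M0: "0 \<le> M" using L_nonneg n1 by (simp add: zero_le_mult_iff)
  let ?u = "deriv (conv k profile) x"
  show ?thesis
  proof (cases "\<bar>x\<bar> \<le> 4 / real n")
    case True
    have "\<bar>?u\<bar> \<le> 2 * (1 / real n) * (real n ^ 2 * M) * profile (K + 1)"
      by (rule deriv_conv_abs_le[OF mono_profile R])
    also have "\<dots> = 2 * real n * (M * profile (K + 1))"
      using n1 by (simp add: power2_eq_square)
    finally have "\<bar>x\<bar> * \<bar>?u\<bar> \<le> (4 / real n) * (2 * real n * (M * profile (K + 1)))"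
      using True by (intro mult_mono) auto
    also have "\<dots> = 8 * (M * profile (K + 1))" using n1 by simp
    finally show ?thesis by (simp add: abs_mult add_increasing2)
  next
    case False
    then have x0: "0 < \<bar>x\<bar>" using n1 by (smt (verit) divide_nonneg_pos)
    \<comment> \<open>The choice m = |x|/2 leaves room for the window of radius 2/n exactly because
      |x| >= 4/n.\<close>
    have "?u \<le> (\<bar>x\<bar> / 2) powr (\<alpha> - 1)"
      using False x0 by (intro deriv_conv_profile_le[OF assms(2)]) auto
    moreover have "0 \<le> ?u"
      using deriv_conv_profile_ge[OF assms(2) order_refl] powr_ge_zero order_trans by blast
    ultimately have "\<bar>x\<bar> * \<bar>?u\<bar> \<le> 2 * (\<bar>x\<bar> / 2 * (\<bar>x\<bar> / 2) powr (\<alpha> - 1))"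
      by (simp add: mult_left_mono)
    also have "\<bar>x\<bar> / 2 * (\<bar>x\<bar> / 2) powr (\<alpha> - 1) = (\<bar>x\<bar> / 2) powr \<alpha>"
      using x0 powr_add[of "\<bar>x\<bar> / 2" 1 "\<alpha> - 1"] by simp
    also have "2 * \<dots> \<le> 2 * K powr \<alpha>"
      using assms(3) \<alpha>_pos by (intro mult_left_mono powr_mono2) auto
    finally show ?thesis using M0 R0 by (simp add: abs_mult add_increasing)
  qed
qed

section \<open>Pointwise limits of the mollified profile and its derivative\<close>

lemma conv_profile_tendsto:
  assumes k: "\<And>n. 0 < n \<Longrightarrow> smoothing_kernel (k n) (k' n) (1 / real n) (L n)" and "x \<noteq> 0"
  shows "(\<lambda>n. conv (k n) profile x) \<longlonglongrightarrow> profile x"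
proof (rule tendsto_sandwich)
  have pos: "\<forall>\<^sub>F n::nat in sequentially. 0 < n" by (rule eventually_gt_at_top)
  show "\<forall>\<^sub>F n in sequentially. profile (x - 1 / real n) \<le> conv (k n) profile x"
    by (rule eventually_mono[OF pos]) (rule smoothing_kernel.conv_between(1)[OF k mono_profile])
  show "\<forall>\<^sub>F n in sequentially. conv (k n) profile x \<le> profile (x + 1 / real n)"
    by (rule eventually_mono[OF pos]) (rule smoothing_kernel.conv_between(2)[OF k mono_profile])
  have "isCont profile x"
    using profile_has_derivative[OF assms(2)] by (rule DERIV_isCont)
  moreover have "(\<lambda>n. x - 1 / real n) \<longlonglongrightarrow> x - 0" "(\<lambda>n. x + 1 / real n) \<longlonglongrightarrow> x + 0"
    by (intro tendsto_intros lim_1_over_n)+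
  ultimately show "(\<lambda>n. profile (x - 1 / real n)) \<longlonglongrightarrow> profile x"
    and "(\<lambda>n. profile (x + 1 / real n)) \<longlonglongrightarrow> profile x"
    using isCont_tendsto_compose[of x profile] by auto
qed

text \<open>The slope bounds on the window of radius 2/n squeeze the derivative between (|x| +
  2/n)^(\<alpha> - 1) and (|x| - 2/n)^(\<alpha> - 1).\<close>

lemma deriv_conv_profile_tendsto:
  assumes k: "\<And>n. 0 < n \<Longrightarrow> smoothing_kernel (k n) (k' n) (1 / real n) (L n)" and "x \<noteq> 0"
  shows "(\<lambda>n. deriv (conv (k n) profile) x) \<longlonglongrightarrow> \<bar>x\<bar> powr (\<alpha> - 1)"
proof (rule tendsto_sandwich)
  have pos: "\<forall>\<^sub>F n::nat in sequentially. 0 < n" by (rule eventually_gt_at_top)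
  show "\<forall>\<^sub>F n in sequentially. (\<bar>x\<bar> + 2 * (1 / real n)) powr (\<alpha> - 1) \<le> deriv (conv (k n) profile) x"
    by (rule eventually_mono[OF pos]) (rule deriv_conv_profile_ge[OF k order_refl])
  have lim: "(\<lambda>n. \<bar>x\<bar> - 2 * (1 / real n)) \<longlonglongrightarrow> \<bar>x\<bar> - 2 * 0"
    "(\<lambda>n. \<bar>x\<bar> + 2 * (1 / real n)) \<longlonglongrightarrow> \<bar>x\<bar> + 2 * 0"
    by (intro tendsto_intros lim_1_over_n)+
  \<comment> \<open>The upper bound requires the window to miss 0, which holds only for large
    n.\<close>
  have "\<forall>\<^sub>F n in sequentially. 0 < \<bar>x\<bar> - 2 * (1 / real n)"
    by (rule order_tendstoD(1)[OF lim(1)]) (use assms(2) in simp)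
  with pos show "\<forall>\<^sub>F n in sequentially. deriv (conv (k n) profile) x \<le> (\<bar>x\<bar> - 2 * (1 / real n)) powr (\<alpha> - 1)"
  proof eventually_elim
    case (elim n)
    then show ?case by (intro deriv_conv_profile_le[OF k]) auto
  qed
  show "(\<lambda>n. (\<bar>x\<bar> - 2 * (1 / real n)) powr (\<alpha> - 1)) \<longlonglongrightarrow> \<bar>x\<bar> powr (\<alpha> - 1)"
    and "(\<lambda>n. (\<bar>x\<bar> + 2 * (1 / real n)) powr (\<alpha> - 1)) \<longlonglongrightarrow> \<bar>x\<bar> powr (\<alpha> - 1)"
    using lim assms(2) by (auto intro!: tendsto_powr)
qed

section \<open>Passage to the limit in the weak form\<close>

text \<open>Away from \<open>0\<close> the integrand is the derivative of \<open>flux x * \<psi> x\<close>, and \<open>flux\<close> is continuous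
  at \<open>0\<close> although \<open>velocity\<close> jumps there.\<close>

lemma weak_form_limit:
  assumes \<psi>: "\<And>x. (\<psi> has_real_derivative \<psi>' x) (at x)"
    and vanish: "\<And>x. K \<le> \<bar>x\<bar> \<Longrightarrow> \<psi> x = 0" "\<And>x. K \<le> \<bar>x\<bar> \<Longrightarrow> \<psi>' x = 0"
    and "0 \<le> K"
    and int: "integrable lborel (\<lambda>x. flux x * \<psi>' x - velocity x * \<psi> x)"
  shows "(LBINT x. flux x * \<psi>' x - velocity x * \<psi> x) = 0"
proof -
  let ?g = "\<lambda>x. flux x * \<psi>' x - velocity x * \<psi> x"
  have "(?g has_integral flux K * \<psi> K - flux (- K) * \<psi> (- K)) {- K..K}"
  proof (rule fundamental_theorem_of_calculus_interior_strong[where S="{0}"])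
    show "continuous_on {- K..K} (\<lambda>x. flux x * \<psi> x)"
      using \<psi>[THEN DERIV_isCont]
      by (intro continuous_on_mult continuous_on_subset[OF continuous_flux]
          continuous_at_imp_continuous_on) auto
    fix x assume "x \<in> {- K<..<K} - {0}"
    then have "((\<lambda>x. flux x * \<psi> x) has_real_derivative - velocity x * \<psi> x + \<psi>' x * flux x) (at x)"
      by (intro DERIV_mult flux_has_derivative \<psi>) auto
    then show "((\<lambda>x. flux x * \<psi> x) has_vector_derivative ?g x) (at x)"
      by (simp add: has_real_derivative_iff_has_vector_derivative algebra_simps)
  qed (use \<open>0 \<le> K\<close> in auto)
  then have "(?g has_integral 0) {- K..K}"
    using vanish(1)[of K] vanish(1)[of "- K"] by simp
  then have "(?g has_integral 0) UNIV"
    by (rule has_integral_on_superset) (auto simp: vanish)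
  with has_integral_integral_lborel[OF int] show ?thesis
    using has_integral_unique by blast
qed

text \<open>Dominated convergence: the integrands are bounded uniformly on a fixed interval and
  converge off 0 to the integrand of \<open>weak_form_limit\<close>. The assumption on \<gamma> is
  \<alpha> = (\<gamma> - 1) / (\<gamma> + 1) solved for \<gamma>.\<close>

lemma slic_limit:
  fixes \<gamma> :: real
  assumes \<phi>: "mollifier \<phi>" and \<psi>: "Cc1 \<psi>" and \<gamma>: "\<gamma> = (1 + \<alpha>) / (1 - \<alpha>)"
  shows "(\<lambda>n. LINT x|lebesgue.
     (pressure \<gamma> (u_seq \<phi> profile n x) - x * v_seq \<phi> profile n x) * deriv \<psi> x
       - v_seq \<phi> profile n x * \<psi> x) \<longlonglongrightarrow> 0"
proof -
  obtain M where k: "\<And>n. 0 < n \<Longrightarrow>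
    smoothing_kernel (scaled \<phi> n) (\<lambda>s. real n ^ 2 * deriv \<phi> (real n * s)) (1 / real n) (real n ^ 2 * M)"
    using mollifier_kernel[OF \<phi>] by blast
  define R where "R n = conv (scaled \<phi> n) profile" for n
  define U where "U n = deriv (R n)" for n
  define V where "V n x = R n x - x * U n x" for n x
  define F where "F n x = (pressure \<gamma> (U n x) - x * V n x) * deriv \<psi> x - V n x * \<psi> x" for n x
  have F_eq: "(\<lambda>n. LINT x|lebesgue.
     (pressure \<gamma> (u_seq \<phi> profile n x) - x * v_seq \<phi> profile n x) * deriv \<psi> x
       - v_seq \<phi> profile n x * \<psi> x) = (\<lambda>n. LINT x|lebesgue. F n x)"
    unfolding F_def V_def U_def R_def u_seq_def v_seq_def r_seq_def ..

  obtain D where D: "\<And>x. (\<psi> has_vector_derivative D x) (at x)" and contD: "continuous_on UNIV D"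
    using \<psi> unfolding Cc1_def C1_differentiable_on_def by auto
  have d\<psi>: "(\<psi> has_real_derivative deriv \<psi> x) (at x)" for x
    using D[of x] DERIV_imp_deriv by (metis has_real_derivative_iff_has_vector_derivative)
  have "deriv \<psi> = D"
    using D DERIV_imp_deriv by (metis ext has_real_derivative_iff_has_vector_derivative)
  with contD have contD\<psi>: "continuous_on UNIV (deriv \<psi>)" by simp
  have cont\<psi>: "continuous_on UNIV \<psi>"
    using d\<psi>[THEN DERIV_isCont] by (intro continuous_at_imp_continuous_on) auto
  have [measurable]: "\<psi> \<in> borel_measurable borel" "deriv \<psi> \<in> borel_measurable borel"
    by (intro borel_measurable_continuous_onI cont\<psi> contD\<psi>)+
  have cs: "compact (supp \<psi>)" using \<psi> unfolding Cc1_def by simp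
  have cs': "compact (supp (deriv \<psi>))"
    by (rule compact_supp_deriv[OF cs])
  obtain B\<^sub>0 where B\<^sub>0: "\<And>x. \<bar>\<psi> x\<bar> \<le> B\<^sub>0"
    using bounded_of_compact_supp[OF cs cont\<psi>] by auto
  obtain B\<^sub>1 where B\<^sub>1: "\<And>x. \<bar>deriv \<psi> x\<bar> \<le> B\<^sub>1"
    using bounded_of_compact_supp[OF cs' contD\<psi>] by auto
  obtain K\<^sub>0 where K\<^sub>0: "\<forall>x\<in>supp \<psi>. \<bar>x\<bar> \<le> K\<^sub>0"
    using compact_imp_bounded[OF cs] by (auto simp: bounded_iff)
  \<comment> \<open>The summand 1 puts the points with |x| = K strictly outside the support.\<close>
  define K where "K = \<bar>K\<^sub>0\<bar> + 1"
  have K: "0 \<le> K" unfolding K_def by simp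
  have out: "\<psi> x = 0" "deriv \<psi> x = 0" if "K \<le> \<bar>x\<bar>" for x
  proof -
    have "x \<notin> supp \<psi>" using K\<^sub>0 that unfolding K_def by force
    then show "\<psi> x = 0" "deriv \<psi> x = 0"
      using supp_deriv_subset[of \<psi>] by (auto intro: supp_vanish)
  qed

  \<comment> \<open>For |x| <= K and n > 0, \<open>r\<^sub>0\<close> bounds |R n x|,
    \<open>q\<close> bounds |x * U n x|, and \<open>p\<close> bounds the pressure. The shifts K + 1
    and K + 2 allow for 1/n <= 1 and 2/n <= 2; the negative exponent -\<gamma> turns the lower bound
    on U n x into an upper bound.\<close>
  define r\<^sub>0 where "r\<^sub>0 = profile (K + 1)"
  define q where "q = 8 * (M * r\<^sub>0) + 2 * K powr \<alpha>"
  define p where "p = 1 / \<gamma> * ((K + 2) powr (\<alpha> - 1)) powr (- \<gamma>)"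
  have \<gamma>_pos: "0 < \<gamma>" unfolding \<gamma> using \<alpha>_pos \<alpha>_less by simp
  have bound: "\<bar>F n x\<bar> \<le> ((p + K * (r\<^sub>0 + q)) * B\<^sub>1 + (r\<^sub>0 + q) * B\<^sub>0) * indicator {- K..K} x"
    if n: "0 < n" for n x
  proof (cases "K < \<bar>x\<bar>")
    case True
    then show ?thesis by (auto simp: F_def out indicator_def)
  next
    case False
    then have x: "\<bar>x\<bar> \<le> K" by simp
    have d1: "1 / real n \<le> 1" using n by simp
    have "\<bar>R n x\<bar> \<le> r\<^sub>0"
    proof -
      have "profile (- (K + 1)) \<le> profile (x - 1 / real n)" "profile (x + 1 / real n) \<le> profile (K + 1)"
        using x d1 by (intro monoD[OF mono_profile]; linarith)+
      then show ?thesis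
        using smoothing_kernel.conv_between[OF k[OF n] mono_profile, of x]
          profile_minus[of "K + 1"]
        unfolding R_def r\<^sub>0_def by linarith
    qed
    moreover have xu: "\<bar>x * U n x\<bar> \<le> q"
      unfolding U_def R_def q_def r\<^sub>0_def by (rule weighted_deriv_conv_profile_bound[OF n k[OF n] x])
    ultimately have v: "\<bar>V n x\<bar> \<le> r\<^sub>0 + q" unfolding V_def by linarith
    have "(K + 2) powr (\<alpha> - 1) \<le> U n x"
      unfolding U_def R_def using x d1 by (intro deriv_conv_profile_ge[OF k[OF n]]) linarith
    then have "U n x powr (- \<gamma>) \<le> ((K + 2) powr (\<alpha> - 1)) powr (- \<gamma>)"
      using \<gamma>_pos K by (intro powr_mono2') auto
    then have P: "\<bar>pressure \<gamma> (U n x)\<bar> \<le> p"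
      unfolding pressure_def p_def using \<gamma>_pos by (simp add: abs_mult divide_right_mono)
    have "\<bar>x * V n x\<bar> \<le> K * (r\<^sub>0 + q)"
      unfolding abs_mult using x v K by (intro mult_mono) auto
    then have "\<bar>pressure \<gamma> (U n x) - x * V n x\<bar> \<le> p + K * (r\<^sub>0 + q)"
      using P by linarith
    then have "\<bar>(pressure \<gamma> (U n x) - x * V n x) * deriv \<psi> x\<bar> \<le> (p + K * (r\<^sub>0 + q)) * B\<^sub>1"
      unfolding abs_mult using B\<^sub>1 by (intro mult_mono) auto
    moreover have "\<bar>V n x * \<psi> x\<bar> \<le> (r\<^sub>0 + q) * B\<^sub>0"
      unfolding abs_mult using B\<^sub>0 v by (intro mult_mono) auto
    ultimately have "\<bar>F n x\<bar> \<le> (p + K * (r\<^sub>0 + q)) * B\<^sub>1 + (r\<^sub>0 + q) * B\<^sub>0"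
      unfolding F_def by linarith
    then show ?thesis using x by (auto simp: indicator_def)
  qed

  have Fm: "F n \<in> borel_measurable borel" if n: "0 < n" for n
  proof -
    have d: "(R n has_real_derivative U n x) (at x)" for x
      unfolding U_def R_def by (rule smoothing_kernel.conv_has_deriv[OF k[OF n] mono_profile])
    then have [measurable]: "U n \<in> borel_measurable borel"
      by (rule borel_measurable_derivative)
    have [measurable]: "R n \<in> borel_measurable borel"
      using d[THEN DERIV_isCont]
      by (intro borel_measurable_continuous_onI continuous_at_imp_continuous_on) auto
    show ?thesis unfolding F_def V_def pressure_def by measurable
  qed

  let ?g = "\<lambda>x. flux x * deriv \<psi> x - velocity x * \<psi> x"
  have pointwise: "(\<lambda>n. F n x) \<longlonglongrightarrow> ?g x" if "x \<noteq> 0" for x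
  proof -
    have R: "(\<lambda>n. R n x) \<longlonglongrightarrow> profile x"
      unfolding R_def by (rule conv_profile_tendsto[OF k that])
    have U: "(\<lambda>n. U n x) \<longlonglongrightarrow> \<bar>x\<bar> powr (\<alpha> - 1)"
      unfolding U_def R_def by (rule deriv_conv_profile_tendsto[OF k that])
    have V: "(\<lambda>n. V n x) \<longlonglongrightarrow> velocity x"
      unfolding V_def velocity_def by (intro tendsto_intros R U)
    have "(\<lambda>n. pressure \<gamma> (U n x)) \<longlonglongrightarrow> 1 / \<gamma> * (\<bar>x\<bar> powr (\<alpha> - 1)) powr (- \<gamma>)"
      unfolding pressure_def using that by (intro tendsto_intros U) auto
    \<comment> \<open>These identities put the limit pressure into the form used in
      \<open>flux\<close>.\<close>
    moreover have "1 / \<gamma> = (1 - \<alpha>) / (1 + \<alpha>)" and "(\<alpha> - 1) * (- \<gamma>) = 1 + \<alpha>"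
      unfolding \<gamma> using \<alpha>_less by (simp_all add: field_simps)
    ultimately have P: "(\<lambda>n. pressure \<gamma> (U n x)) \<longlonglongrightarrow> (1 - \<alpha>) / (1 + \<alpha>) * \<bar>x\<bar> powr (1 + \<alpha>)"
      by (simp only: powr_powr)
    show ?thesis
      unfolding F_def flux_def by (intro tendsto_intros P V)
  qed
  \<comment> \<open>The index is shifted because \<open>scaled \<phi> 0\<close> is identically 0 and
    the bounds hold for n > 0; \<open>LIMSEQ_imp_Suc\<close> undoes the shift at the end.\<close>
  have "(\<lambda>n. LBINT x. F (Suc n) x) \<longlonglongrightarrow> (LBINT x. ?g x)" and int: "integrable lborel ?g"
  proof -
    let ?w = "\<lambda>x. ((p + K * (r\<^sub>0 + q)) * B\<^sub>1 + (r\<^sub>0 + q) * B\<^sub>0) * indicator {- K..K} x :: real"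
    have [measurable]: "flux \<in> borel_measurable borel"
      by (rule borel_measurable_continuous_onI[OF continuous_flux])
    have g: "?g \<in> borel_measurable lborel" by measurable
    have F: "F (Suc n) \<in> borel_measurable lborel" for n using Fm[of "Suc n"] by simp
    have w: "integrable lborel ?w" by (rule integrable_const_indicator)
    have lim: "AE x in lborel. (\<lambda>n. F (Suc n) x) \<longlonglongrightarrow> ?g x"
      using AE_lborel_singleton[of 0] by eventually_elim (intro LIMSEQ_Suc pointwise)
    have dom: "AE x in lborel. norm (F (Suc n) x) \<le> ?w x" for n
      using bound[of "Suc n"] by simp
    show "(\<lambda>n. LBINT x. F (Suc n) x) \<longlonglongrightarrow> (LBINT x. ?g x)"
      by (rule integral_dominated_convergence[OF g F w lim dom])
    show "integrable lborel ?g"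
      by (rule integrable_dominated_convergence[OF g F w lim dom])
  qed
  moreover have "(LBINT x. ?g x) = 0"
    by (rule weak_form_limit[OF d\<psi> out K int])
  moreover have "(LINT x|lebesgue. F (Suc n) x) = (LBINT x. F (Suc n) x)" for n
    using Fm[of "Suc n"] by (intro integral_completion) simp
  ultimately have "(\<lambda>n. LINT x|lebesgue. F (Suc n) x) \<longlonglongrightarrow> 0" by simp
  then show ?thesis
    unfolding F_eq by (rule LIMSEQ_imp_Suc)
qed

end

section \<open>Independence of the value at 0, and the theorem\<close>

lemma L1_loc_mono_eq_off_0:
  assumes "mono f" and eq: "\<And>x. x \<noteq> 0 \<Longrightarrow> r x = f x"
  shows "r \<in> borel_measurable borel" and "L1_loc r"
proof -
  have [measurable]: "f \<in> borel_measurable borel"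
    using assms(1) by (rule borel_measurable_mono)
  have "r = (\<lambda>x. if x = 0 then r 0 else f x)"
    using eq by auto
  moreover have "(\<lambda>x. if x = 0 then r 0 else f x) \<in> borel_measurable borel"
    by measurable
  ultimately show rm [measurable]: "r \<in> borel_measurable borel" by simp
  show "L1_loc r"
    unfolding L1_loc_def
  proof (intro allI impI)
    fix S :: "real set"
    assume S: "compact S"
    then have [measurable]: "S \<in> sets borel" by (simp add: borel_compact)
    obtain b where b: "\<forall>x\<in>S. \<bar>x\<bar> \<le> b"
      using compact_imp_bounded[OF S] by (auto simp: bounded_iff)
    have "integrable lborel (\<lambda>x. indicator S x *\<^sub>R r x)"
    proof (rule integrable_bounded_support[where a="- b" and b=b])
      \<comment> \<open>The term |r 0| accounts for the value at 0, which is arbitrary.\<close>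
      show "\<bar>indicator S x *\<^sub>R r x\<bar> \<le> (\<bar>f (- b)\<bar> + \<bar>f b\<bar> + \<bar>r 0\<bar>) * indicator {- b..b} x" for x
      proof (cases "x \<in> S")
        case True
        then have "- b \<le> x" "x \<le> b" using b by (force simp: abs_le_iff)+
        moreover have "\<bar>r x\<bar> \<le> \<bar>f (- b)\<bar> + \<bar>f b\<bar> + \<bar>r 0\<bar>"
          using mono_abs_le[OF assms(1) \<open>- b \<le> x\<close> \<open>x \<le> b\<close>] eq[of x] by (cases "x = 0") auto
        ultimately show ?thesis using True by simp
      qed simp
    qed measurable
    then show "r absolutely_integrable_on S"
      unfolding set_integrable_def by (subst integrable_completion) auto
  qed
qed

text \<open>A single point is a null set, so mollification does not see it. This transfers results
  on \<open>profile\<close> to a function whose value at 0 is unspecified.\<close>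

lemma conv_cong_off_0:
  assumes [measurable]: "k \<in> borel_measurable borel" "f \<in> borel_measurable borel" "r \<in> borel_measurable borel"
    and eq: "\<And>x. x \<noteq> 0 \<Longrightarrow> r x = f x"
  shows "conv k r = conv k f"
proof
  fix x
  have "(LBINT \<eta>. k (x - \<eta>) * r \<eta>) = (LBINT \<eta>. k (x - \<eta>) * f \<eta>)"
  proof (rule integral_cong_AE)
    show "AE \<eta> in lborel. k (x - \<eta>) * r \<eta> = k (x - \<eta>) * f \<eta>"
      using AE_lborel_singleton[of 0] by eventually_elim (simp add: eq)
  qed measurable
  then show "conv k r x = conv k f x"
    unfolding conv_def by (subst (1 2) integral_completion) auto
qed

theorem theorem4p4:
  fixes \<gamma> ubar vbar w :: real and r :: "real \<Rightarrow> real"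
  assumes "\<gamma> > 1" and "ubar > 0" and "vbar > 0"
    and "w = ubar powr ((1 - \<gamma>) / 2) + (1 - \<gamma>) / 2 * vbar" and "w < 0"
    and "\<And>\<xi>. \<xi> > 0 \<Longrightarrow>
           r \<xi> = (\<gamma> + 1) / (\<gamma> - 1) * \<xi> powr ((\<gamma> - 1) / (\<gamma> + 1)) - 2 / (\<gamma> - 1) * w"
    and "\<And>\<xi>. \<xi> < 0 \<Longrightarrow> r \<xi> = - r (- \<xi>)"
  shows "self_similar_slic_solution \<gamma> (\<lambda>x t. t * r (x / t))"
proof -
  define \<alpha> where "\<alpha> = (\<gamma> - 1) / (\<gamma> + 1)"
  \<comment> \<open>This is the right-hand limit of r at 0, half the height of its jump there; it is
    positive because w < 0.\<close>
  define c where "c = - (2 / (\<gamma> - 1) * w)"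
  interpret power_profile \<alpha> c
  proof
    show "0 < \<alpha>" "\<alpha> < 1" using \<open>\<gamma> > 1\<close> by (simp_all add: \<alpha>_def)
    show "0 \<le> c" using \<open>\<gamma> > 1\<close> \<open>w < 0\<close> by (simp add: c_def divide_nonpos_pos mult_nonneg_nonpos)
  qed
  have \<gamma>: "\<gamma> = (1 + \<alpha>) / (1 - \<alpha>)"
    using \<open>\<gamma> > 1\<close> by (simp add: \<alpha>_def field_simps)
  have pos: "r x = profile x" if "0 < x" for x
  proof -
    have "r x = (\<gamma> + 1) / (\<gamma> - 1) * x powr \<alpha> + c"
      using assms(6)[OF that] by (simp add: \<alpha>_def c_def)
    moreover have "(\<gamma> + 1) / (\<gamma> - 1) = 1 / \<alpha>"
      by (simp add: \<alpha>_def)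
    ultimately show ?thesis using that by (simp add: profile_def)
  qed
  have eq: "r x = profile x" if "x \<noteq> 0" for x
  proof (cases "0 < x")
    case False
    then show ?thesis
      using that assms(7)[of x] pos[of "- x"] by (simp add: profile_minus)
  qed (rule pos)
  note r = L1_loc_mono_eq_off_0[OF mono_profile eq]
  have r_seq_eq: "r_seq \<phi> r n = r_seq \<phi> profile n" if \<phi>: "mollifier \<phi>" for \<phi> n
  proof -
    obtain M where k: "\<And>n. 0 < n \<Longrightarrow>
      smoothing_kernel (scaled \<phi> n) (\<lambda>s. real n ^ 2 * deriv \<phi> (real n * s)) (1 / real n) (real n ^ 2 * M)"
      using mollifier_kernel[OF \<phi>] by blast
    have "scaled \<phi> n \<in> borel_measurable borel"
      using smoothing_kernel.measurable_kernel[OF k[of n]]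
      by (cases "0 < n") (auto simp: scaled_def)
    then show ?thesis
      unfolding r_seq_def by (rule conv_cong_off_0[OF _ measurable_profile r(1) eq])
  qed
  show ?thesis
    unfolding self_similar_slic_solution_def
  proof (intro exI[of _ r] conjI allI impI)
    show "L1_loc r" by (rule r(2))
    fix \<phi> assume \<phi>: "mollifier \<phi>"
    obtain M where k: "\<And>n. 0 < n \<Longrightarrow>
      smoothing_kernel (scaled \<phi> n) (\<lambda>s. real n ^ 2 * deriv \<phi> (real n * s)) (1 / real n) (real n ^ 2 * M)"
      using mollifier_kernel[OF \<phi>] by blast
    show "0 < u_seq \<phi> r n x" if n: "0 < n" for n x
    proof -
      \<comment> \<open>The smallest radius around 0 that contains the window of radius 2/n about x
        gives a positive lower bound for u_n at x.\<close>
      have "0 < (\<bar>x\<bar> + 2 * (1 / real n)) powr (\<alpha> - 1)"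
        using n by (simp add: add_nonneg_eq_0_iff)
      also have "\<dots> \<le> u_seq \<phi> r n x"
        unfolding u_seq_def r_seq_eq[OF \<phi>] unfolding r_seq_def
        by (rule deriv_conv_profile_ge[OF k[OF n] order_refl])
      finally show ?thesis .
    qed
    fix \<psi> assume \<psi>: "Cc1 \<psi>"
    have "u_seq \<phi> r = u_seq \<phi> profile" "v_seq \<phi> r = v_seq \<phi> profile"
      unfolding u_seq_def[abs_def] v_seq_def[abs_def] r_seq_eq[OF \<phi>] by (rule refl)+
    then show "(\<lambda>n. LINT x|lebesgue.
        (pressure \<gamma> (u_seq \<phi> r n x) - x * v_seq \<phi> r n x) * deriv \<psi> x
          - v_seq \<phi> r n x * \<psi> x) \<longlonglongrightarrow> 0"
      using slic_limit[OF \<phi> \<psi> \<gamma>] by simp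
  qed simp
qed

end
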